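(* If $H$ is a subgroup of $PL_o(I)$ and $H$ admits a transition chain of length two, then $H$ admits infinite towers (towers of infinite cardinality).
   Context: $I=[0,1]$. $PL_o(I)$ is the group, under composition, of orientation-preserving piecewise-linear homeomorphisms of $I$ with finitely many breaks in slope. Elements act on the right. An orbital of a subgroup $G\le PL_o(I)$ is the convex hull of the orbit of a point of $I$ under $G$, provided this set has more than one element; orbitals are open intervals. An orbital of an element $g$ is an orbital of $\langle g\rangle$. A signed orbital of $G$ is a pair $(A,g)$ with $g\in G$ and $A$ an orbital of $g$. The left total order on $PL_o(I)$: for two distinct elements there is a maximal $x\in[0,1)$ such that they agree on $[0,x]$; the one with the larger right-hand derivative at $x$ is declared the larger. Signed orbitals are partially ordered lexicographically: $(A,g)\le (B,h)$ iff $A\subsetneq B$, or $A=B$ and $g\le h$ in the left total order. A tower of $G$ is a set $T$ of signed orbitals of $G$ such that (1) $T$ is a chain in this partial order, and (2) for each $A$ occurring as the orbital of some element of $T$, $T$ has exactly one element of the form $(A,g)$. $G$ admits a transition chain of length two if it has two signed orbitals $(A,g)$, $(B,h)$ with $A=(a_1,a_2)$, $B=(b_1,b_2)$ and $a_1<b_1<a_2<b_2$. *)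

theory Defs
  imports "HOL-Analysis.Analysis" "HOL-Algebra.Generated_Groups"
begin

(* Finitely many breaks: f is affine on every closed subinterval of the unit interval whose
   interior contains no point of some finite set B. *)
definition piecewise_linear :: "(real \<Rightarrow> real) \<Rightarrow> bool" where
  "piecewise_linear f \<longleftrightarrow> (\<exists>B. finite B \<and>
     (\<forall>a b. 0 \<le> a \<and> a < b \<and> b \<le> 1 \<and> {a<..<b} \<inter> B = {} \<longrightarrow>
       (\<exists>m c. \<forall>t\<in>{a..b}. f t = m * t + c)))"

(* A homeomorphism of the unit interval is represented by its extensional function, so that
   distinct HOL functions in the carrier are distinct maps of the interval.
   Elements act on the right: the product of f and g is "first f, then g". *)
definition PLo :: "(real \<Rightarrow> real) monoid" where
  "PLo = \<lparr>carrier = {f \<in> extensional {0..1}.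
              (\<exists>g. homeomorphism {0..1} {0..1} f g) \<and> strict_mono_on {0..1} f \<and>
              piecewise_linear f},
          monoid.mult = (\<lambda>f g. compose {0..1} g f),
          one = (\<lambda>x\<in>{0..1}. x)\<rparr>"

definition orbital :: "(real \<Rightarrow> real) set \<Rightarrow> real set \<Rightarrow> bool" where
  "orbital G A \<longleftrightarrow> (\<exists>x\<in>{0..1}. A = convex hull ((\<lambda>g. g x) ` G) \<and> (\<exists>y\<in>A. \<exists>z\<in>A. y \<noteq> z))"

definition element_orbital :: "(real \<Rightarrow> real) \<Rightarrow> real set \<Rightarrow> bool" where
  "element_orbital g A \<longleftrightarrow> orbital (generate PLo {g}) A"

definition signed_orbital :: "(real \<Rightarrow> real) set \<Rightarrow> real set \<times> (real \<Rightarrow> real) \<Rightarrow> bool" where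
  "signed_orbital G p \<longleftrightarrow> snd p \<in> G \<and> element_orbital (snd p) (fst p)"

definition agree_upto :: "(real \<Rightarrow> real) \<Rightarrow> (real \<Rightarrow> real) \<Rightarrow> real \<Rightarrow> bool" where
  "agree_upto f g x \<longleftrightarrow> 0 \<le> x \<and> x < 1 \<and> (\<forall>t\<in>{0..x}. f t = g t)"

definition left_less :: "(real \<Rightarrow> real) \<Rightarrow> (real \<Rightarrow> real) \<Rightarrow> bool" where
  "left_less f g \<longleftrightarrow> f \<noteq> g \<and>
     (\<exists>x m n. agree_upto f g x \<and> (\<forall>y. agree_upto f g y \<longrightarrow> y \<le> x) \<and>
        (f has_real_derivative m) (at_right x) \<and> (g has_real_derivative n) (at_right x) \<and> m < n)"

definition signed_orbital_le ::
  "real set \<times> (real \<Rightarrow> real) \<Rightarrow> real set \<times> (real \<Rightarrow> real) \<Rightarrow> bool" where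
  "signed_orbital_le p q \<longleftrightarrow> fst p \<subset> fst q \<or>
     (fst p = fst q \<and> (snd p = snd q \<or> left_less (snd p) (snd q)))"

definition tower :: "(real \<Rightarrow> real) set \<Rightarrow> (real set \<times> (real \<Rightarrow> real)) set \<Rightarrow> bool" where
  "tower G T \<longleftrightarrow> (\<forall>p\<in>T. signed_orbital G p) \<and>
     Complete_Partial_Order.chain signed_orbital_le T \<and>
     (\<forall>A\<in>fst ` T. \<exists>!g. (A, g) \<in> T)"

definition admits_transition_chain_two :: "(real \<Rightarrow> real) set \<Rightarrow> bool" where
  "admits_transition_chain_two G \<longleftrightarrow> (\<exists>a1 a2 b1 b2 g h.
     signed_orbital G ({a1<..<a2}, g) \<and> signed_orbital G ({b1<..<b2}, h) \<and>
     a1 < b1 \<and> b1 < a2 \<and> a2 < b2)"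

lemma PLo_carrierI:
  assumes "f \<in> extensional {0..1}" "homeomorphism {0..1} {0..1} f g"
    "strict_mono_on {0..1} f" "piecewise_linear f"
  shows "f \<in> carrier PLo"
  using assms unfolding PLo_def by auto

lemma piecewise_linear_comp:
  assumes f: "f ` {0..1} = {0..1}" "strict_mono_on {0..1} f" "piecewise_linear f"
    and g: "piecewise_linear g"
  shows "piecewise_linear (compose {0..1} g f)"
proof -
  obtain B where B: "finite B" "\<And>a b. 0 \<le> a \<and> a < b \<and> b \<le> 1 \<and> {a<..<b} \<inter> B = {} \<Longrightarrow>
       (\<exists>m c. \<forall>t\<in>{a..b}. f t = m * t + c)"
    using f(3) unfolding piecewise_linear_def by metis
  obtain C where C: "finite C" "\<And>a b. 0 \<le> a \<and> a < b \<and> b \<le> 1 \<and> {a<..<b} \<inter> C = {} \<Longrightarrow>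
       (\<exists>m c. \<forall>t\<in>{a..b}. g t = m * t + c)"
    using g unfolding piecewise_linear_def by metis
  have inj: "inj_on f {0..1}" using f(2) by (rule strict_mono_on_imp_inj_on)
  define D where "D = B \<union> (inv_into {0..1} f ` C)"
  have "finite D" using B C by (simp add: D_def)
  moreover have "\<exists>m c. \<forall>t\<in>{a..b}. compose {0..1} g f t = m * t + c"
    if ab: "0 \<le> a" "a < b" "b \<le> 1" "{a<..<b} \<inter> D = {}" for a b
  proof -
    have "{a<..<b} \<inter> B = {}" using ab by (auto simp: D_def)
    then obtain m c where mc: "\<forall>t\<in>{a..b}. f t = m * t + c" using B(2)[of a b] ab by auto
    have lt: "f a < f b" using strict_mono_onD[OF f(2), of a b] ab by auto
    have rng: "0 \<le> f a" "f b \<le> 1" using f(1) ab by force+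
    have "m * a < m * b" using lt mc ab by auto
    then have m: "m > 0" using ab by (simp add: mult_less_cancel_left)
    have "{f a<..<f b} \<inter> C = {}"
    proof (rule ccontr)
      assume "\<not> ?thesis"
      then obtain y where y: "y \<in> C" "f a < y" "y < f b" by auto
      then have "y \<in> f ` {0..1}" using f(1) rng by auto
      then obtain x where x: "x \<in> {0..1}" "y = f x" by auto
      have "inv_into {0..1} f y = x" using x inj by simp
      then have xD: "x \<in> D" using y(1) unfolding D_def by (metis UnI2 imageI)
      have "a < x" using y x ab strict_mono_onD[OF f(2), of x a] by (cases "x < a"; cases "x = a") auto
      moreover have "x < b" using y x ab strict_mono_onD[OF f(2), of b x] by (cases "b < x"; cases "x = b") auto
      ultimately show False using xD ab by auto
    qed
    then obtain m' c' where mc': "\<forall>t\<in>{f a..f b}. g t = m' * t + c'"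
      using C(2)[of "f a" "f b"] lt rng by auto
    have "compose {0..1} g f t = (m' * m) * t + (m' * c + c')" if t: "t \<in> {a..b}" for t
    proof -
      have "f t \<in> {f a..f b}" using t mc m ab by auto
      then show ?thesis using mc' mc t ab by (simp add: compose_def algebra_simps)
    qed
    then show ?thesis by blast
  qed
  ultimately show ?thesis
    unfolding piecewise_linear_def by (intro exI[of _ D]) simp
qed

lemma piecewise_linear_inv:
  assumes f: "strict_mono_on {0..1} f" "piecewise_linear f"
    and h: "homeomorphism {0..1} {0..1} f g"
  shows "piecewise_linear g" "strict_mono_on {0..1} g"
proof -
  have gf: "g (f x) = x" "f x \<in> {0..1}" if "x \<in> {0..1}" for x
    using h that unfolding homeomorphism_def by auto
  have fg: "f (g x) = x" "g x \<in> {0..1}" if "x \<in> {0..1}" for x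
    using h that unfolding homeomorphism_def by auto
  show sm: "strict_mono_on {0..1} g"
  proof (rule strict_mono_onI)
    fix r s :: real assume rs: "r \<in> {0..1}" "s \<in> {0..1}" "r < s"
    show "g r < g s"
    proof (rule ccontr)
      assume "\<not> ?thesis"
      then have "f (g s) \<le> f (g r)"
        using strict_mono_onD[OF f(1), of "g s" "g r"] fg(2)[OF rs(1)] fg(2)[OF rs(2)]
        by (cases "g s = g r") auto
      then show False using rs fg by auto
    qed
  qed
  obtain B where B: "finite B" "\<And>a b. 0 \<le> a \<and> a < b \<and> b \<le> 1 \<and> {a<..<b} \<inter> B = {} \<Longrightarrow>
       (\<exists>m c. \<forall>t\<in>{a..b}. f t = m * t + c)"
    using f(2) unfolding piecewise_linear_def by metis
  have "\<exists>m c. \<forall>t\<in>{a..b}. g t = m * t + c"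
    if ab: "0 \<le> a" "a < b" "b \<le> 1" "{a<..<b} \<inter> f ` B = {}" for a b
  proof -
    have I: "a \<in> {0..1}" "b \<in> {0..1}" using ab by auto
    have lt: "g a < g b" using strict_mono_onD[OF sm, of a b] I ab by auto
    have "{g a<..<g b} \<inter> B = {}"
    proof (rule ccontr)
      assume "\<not> ?thesis"
      then obtain y where y: "y \<in> B" "g a < y" "y < g b" by auto
      then have yI: "y \<in> {0..1}" using fg(2)[OF I(1)] fg(2)[OF I(2)] by auto
      have "a < f y" "f y < b"
        using strict_mono_onD[OF f(1), of "g a" y] strict_mono_onD[OF f(1), of y "g b"] y yI fg[OF I(1)] fg[OF I(2)]
        by auto
      then show False using y(1) ab(4) by auto
    qed
    then obtain m c where mc: "\<forall>t\<in>{g a..g b}. f t = m * t + c"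
      using B(2)[of "g a" "g b"] lt fg(2)[OF I(1)] fg(2)[OF I(2)] by auto
    have "f (g a) < f (g b)" using ab I fg by auto
    then have "m * g a < m * g b" using mc lt by auto
    then have m: "m > 0" using lt by (simp add: mult_less_cancel_left)
    have "g t = (1/m) * t + (- c / m)" if t: "t \<in> {a..b}" for t
    proof -
      have tI: "t \<in> {0..1}" using t ab by auto
      have "g t \<in> {g a..g b}"
        using strict_mono_onD[OF sm, of a t] strict_mono_onD[OF sm, of t b] t tI I
        by (cases "a = t"; cases "t = b") auto
      then have "t = m * g t + c" using mc fg[OF tI] by auto
      then show ?thesis using m by (simp add: field_simps)
    qed
    then show ?thesis by blast
  qed
  moreover have "finite (f ` B)" using B by simp
  ultimately show "piecewise_linear g"
    unfolding piecewise_linear_def by (intro exI[of _ "f ` B"]) simp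
qed

lemma piecewise_linear_cong:
  assumes "\<And>x. x \<in> {0..1} \<Longrightarrow> f x = g x" "piecewise_linear f"
  shows "piecewise_linear g"
proof -
  obtain B where B: "finite B" "\<And>a b. 0 \<le> a \<and> a < b \<and> b \<le> 1 \<and> {a<..<b} \<inter> B = {} \<Longrightarrow>
       (\<exists>m c. \<forall>t\<in>{a..b}. f t = m * t + c)"
    using assms(2) unfolding piecewise_linear_def by metis
  have "\<exists>m c. \<forall>t\<in>{a..b}. g t = m * t + c"
    if ab: "0 \<le> a" "a < b" "b \<le> 1" "{a<..<b} \<inter> B = {}" for a b
  proof -
    obtain m c where mc: "\<forall>t\<in>{a..b}. f t = m * t + c" using B(2)[of a b] ab by blast
    have "g t = m * t + c" if "t \<in> {a..b}" for t
      using mc that assms(1)[of t] ab by auto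
    then show ?thesis by blast
  qed
  then show ?thesis
    using B(1) unfolding piecewise_linear_def by (intro exI[of _ B]) simp
qed

lemma group_PLo: "group PLo"
proof (rule groupI)
  fix f g assume "f \<in> carrier PLo" "g \<in> carrier PLo"
  then obtain f' g' where fg: "homeomorphism {0..1} {0..1} f f'" "homeomorphism {0..1} {0..1} g g'"
    "strict_mono_on {0..1} f" "strict_mono_on {0..1} g" "piecewise_linear f" "piecewise_linear g"
    by (auto simp: PLo_def)
  have im: "f ` {0..1} = {0..1}" using fg(1) by (simp add: homeomorphism_def)
  have "homeomorphism {0..1} {0..1} (compose {0..1} g f) (f' \<circ> g')"
    by (rule homeomorphism_cong[OF homeomorphism_compose[OF fg(1,2)]]) (auto simp: compose_def)
  moreover have "strict_mono_on {0..1} (compose {0..1} g f)"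
  proof (rule strict_mono_onI)
    fix r s :: real assume rs: "r \<in> {0..1}" "s \<in> {0..1}" "r < s"
    have "f r \<in> {0..1}" "f s \<in> {0..1}" using rs(1,2) im by blast+
    then show "compose {0..1} g f r < compose {0..1} g f s"
      using rs strict_mono_onD[OF fg(3) rs] strict_mono_onD[OF fg(4), of "f r" "f s"]
      by (simp add: compose_def)
  qed
  ultimately have "compose {0..1} g f \<in> carrier PLo"
    using piecewise_linear_comp[OF im fg(3,5,6)] by (intro PLo_carrierI) auto
  then show "f \<otimes>\<^bsub>PLo\<^esub> g \<in> carrier PLo" by (simp add: PLo_def)
next
  have "homeomorphism {0..1} {0..1} (\<lambda>x\<in>{0..1::real}. x) (\<lambda>x. x)"
    by (rule homeomorphism_cong[OF homeomorphism_ident]) auto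
  moreover have "strict_mono_on {0..1} (\<lambda>x\<in>{0..1::real}. x)"
    by (rule strict_mono_onI) auto
  moreover have "piecewise_linear (\<lambda>x\<in>{0..1::real}. x)"
  proof -
    have "\<exists>m c. \<forall>t\<in>{a..b}. t = m * t + c" for a b :: real
      by (rule exI[of _ 1], rule exI[of _ 0]) simp
    then have "piecewise_linear (\<lambda>x. x)"
      unfolding piecewise_linear_def by (intro exI[of _ "{}"]) simp
    then show ?thesis by (rule piecewise_linear_cong[rotated]) auto
  qed
  ultimately have "(\<lambda>x\<in>{0..1::real}. x) \<in> carrier PLo"
    by (intro PLo_carrierI) auto
  then show "\<one>\<^bsub>PLo\<^esub> \<in> carrier PLo" by (simp add: PLo_def)
next
  fix f g h assume "f \<in> carrier PLo" "g \<in> carrier PLo" "h \<in> carrier PLo"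
  then have "f ` {0..1} = {0..1}" by (auto simp: PLo_def homeomorphism_def)
  then have "f \<in> {0..1} \<rightarrow> {0..1}" by blast
  then show "f \<otimes>\<^bsub>PLo\<^esub> g \<otimes>\<^bsub>PLo\<^esub> h = f \<otimes>\<^bsub>PLo\<^esub> (g \<otimes>\<^bsub>PLo\<^esub> h)"
    by (simp add: PLo_def compose_assoc)
next
  fix f assume f: "f \<in> carrier PLo"
  then have "f ` {0..1} = {0..1}" "f \<in> extensional {0..1}" by (auto simp: PLo_def homeomorphism_def)
  then show "\<one>\<^bsub>PLo\<^esub> \<otimes>\<^bsub>PLo\<^esub> f = f"
    by (auto simp: PLo_def compose_def extensional_def fun_eq_iff)
next
  fix f assume "f \<in> carrier PLo"
  then obtain g where fg: "homeomorphism {0..1} {0..1} f g"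
    "strict_mono_on {0..1} f" "piecewise_linear f"
    by (auto simp: PLo_def)
  have g: "g ` {0..1} = {0..1}" "\<And>x. x \<in> {0..1} \<Longrightarrow> f (g x) = x"
    using fg(1) by (auto simp: homeomorphism_def)
  let ?g = "restrict g {0..1}"
  have "homeomorphism {0..1} {0..1} ?g f"
    by (rule homeomorphism_cong[OF homeomorphism_symD[OF fg(1)]]) auto
  moreover have "strict_mono_on {0..1} ?g"
    using piecewise_linear_inv(2)[OF fg(2,3,1)] by (auto simp: strict_mono_on_def)
  moreover have "piecewise_linear ?g"
    by (rule piecewise_linear_cong[OF _ piecewise_linear_inv(1)[OF fg(2,3,1)]]) auto
  ultimately have "?g \<in> carrier PLo" by (intro PLo_carrierI) auto
  moreover have "?g \<otimes>\<^bsub>PLo\<^esub> f = \<one>\<^bsub>PLo\<^esub>"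
    using g by (auto simp: PLo_def compose_def fun_eq_iff)
  ultimately show "\<exists>g\<in>carrier PLo. g \<otimes>\<^bsub>PLo\<^esub> f = \<one>\<^bsub>PLo\<^esub>" by blast
qed

end

(* Replacing elements by their inverses, let g and h move the points of the overlapping orbitals to
   the right.  A piecewise linear map has only finitely many orbitals, so among the overlapping
   pairs of orbitals of g and h moved to the right (the left one belonging to either element) there
   is one, say (a1,a2) of p and (b1,b2) of q, with leftmost a1.  If q moved a1 to the right, the
   orbital of q around a1 would extend the chain further to the left.  Hence q does not increase a1
   while it moves a2 to the right, and the images of (a1,a2) under the powers of q, which are
   orbitals of conjugates of p, form a strictly increasing sequence. *)

theory Submission
  imports Defs
begin

section \<open>Elements of the group as increasing bijections of the unit interval\<close>

interpretation PLo: group PLo by (rule group_PLo)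

lemma PLo_mult_apply: "x \<in> {0..1} \<Longrightarrow> (f \<otimes>\<^bsub>PLo\<^esub> g) x = g (f x)"
  by (simp add: PLo_def compose_def)

lemma PLo_one_apply: "x \<in> {0..1} \<Longrightarrow> \<one>\<^bsub>PLo\<^esub> x = x"
  by (simp add: PLo_def)

lemma PLo_maps: "f \<in> carrier PLo \<Longrightarrow> x \<in> {0..1} \<Longrightarrow> f x \<in> {0..1}"
  by (auto simp: PLo_def homeomorphism_def)

lemma PLo_less_iff:
  assumes "f \<in> carrier PLo" "x \<in> {0..1}" "y \<in> {0..1}"
  shows "f x < f y \<longleftrightarrow> x < y"
  using assms strict_mono_on_less[of "{0..1}" f x y] by (simp add: PLo_def)

lemma PLo_le_iff:
  assumes "f \<in> carrier PLo" "x \<in> {0..1}" "y \<in> {0..1}"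
  shows "f x \<le> f y \<longleftrightarrow> x \<le> y"
  using PLo_less_iff[OF assms(1,3,2)] by (simp add: not_less[symmetric])

lemma PLo_inv_apply:
  assumes "f \<in> carrier PLo" "x \<in> {0..1}"
  shows "(inv\<^bsub>PLo\<^esub> f) (f x) = x" "f ((inv\<^bsub>PLo\<^esub> f) x) = x"
  using PLo.r_inv[OF assms(1)] PLo.l_inv[OF assms(1)]
    PLo_mult_apply[OF assms(2)] PLo_one_apply[OF assms(2)] by metis+

section \<open>Orbits of the cyclic group generated by one element\<close>

abbreviation orbit_of :: "(real \<Rightarrow> real) \<Rightarrow> real \<Rightarrow> real set" where
  "orbit_of f x \<equiv> (\<lambda>k. k x) ` generate PLo {f}"

text \<open>Induction on the generated subgroup. Membership in the unit interval is carried along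
  with \<open>P\<close> because \<open>PLo_mult_apply\<close> evaluates products as compositions
  only there.\<close>

lemma orbit_of_invariant:
  assumes f: "f \<in> carrier PLo" and x: "x \<in> {0..1}" "P x"
    and P: "\<And>y. y \<in> {0..1} \<Longrightarrow> P y \<Longrightarrow> P (f y)"
      "\<And>y. y \<in> {0..1} \<Longrightarrow> P y \<Longrightarrow> P ((inv\<^bsub>PLo\<^esub> f) y)"
    and w: "w \<in> orbit_of f x"
  shows "w \<in> {0..1} \<and> P w"
proof -
  have "\<forall>y\<in>{0..1}. P y \<longrightarrow> k y \<in> {0..1} \<and> P (k y)" if "k \<in> generate PLo {f}" for k
    using that
  proof induction
    case one
    show ?case by (intro ballI impI conjI; subst PLo_one_apply)
  next
    case (incl h) then show ?case using P(1) PLo_maps[OF f] by auto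
  next
    case (inv h) then show ?case using P(2) PLo_maps[OF PLo.inv_closed[OF f]] by auto
  next
    case (eng h1 h2) then show ?case by (metis PLo_mult_apply)
  qed
  then show ?thesis using x w by blast
qed

lemma orbit_of_closed:
  assumes f: "f \<in> carrier PLo" and x: "x \<in> {0..1}"
  shows "x \<in> orbit_of f x"
    and "w \<in> orbit_of f x \<Longrightarrow> f w \<in> orbit_of f x"
    and "w \<in> orbit_of f x \<Longrightarrow> (inv\<^bsub>PLo\<^esub> f) w \<in> orbit_of f x"
    and "w \<in> orbit_of f x \<Longrightarrow> w \<in> {0..1}"
proof -
  show "x \<in> orbit_of f x"
    using PLo_one_apply[OF x] generate.one[of PLo "{f}"] by (metis imageI)
  show "f w \<in> orbit_of f x" if "w \<in> orbit_of f x"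
    using that PLo_mult_apply[OF x] generate.eng[OF _ generate.incl, of _ PLo "{f}" f]
    by (smt (verit) imageE imageI singletonI)
  show "(inv\<^bsub>PLo\<^esub> f) w \<in> orbit_of f x" if "w \<in> orbit_of f x"
    using that PLo_mult_apply[OF x] generate.eng[OF _ generate.inv, of _ PLo "{f}" f]
    by (smt (verit) imageE imageI singletonI)
  show "w \<in> {0..1}" if "w \<in> orbit_of f x"
    using orbit_of_invariant[OF f x, of "\<lambda>_. True"] that by blast
qed

text \<open>Each of the two elements is the inverse of the other, so the orbit of either is stable
  under the moves that generate the orbit of the other.\<close>

lemma orbit_of_inv:
  assumes f: "f \<in> carrier PLo" and x: "x \<in> {0..1}"
  shows "orbit_of (inv\<^bsub>PLo\<^esub> f) x = orbit_of f x"
proof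
  have f': "inv\<^bsub>PLo\<^esub> f \<in> carrier PLo" using f by simp
  show "orbit_of (inv\<^bsub>PLo\<^esub> f) x \<subseteq> orbit_of f x"
    using orbit_of_invariant[OF f' x, of "\<lambda>y. y \<in> orbit_of f x"] orbit_of_closed[OF f x] f
    by (metis PLo.inv_inv subsetI)
  show "orbit_of f x \<subseteq> orbit_of (inv\<^bsub>PLo\<^esub> f) x"
    using orbit_of_invariant[OF f x, of "\<lambda>y. y \<in> orbit_of (inv\<^bsub>PLo\<^esub> f) x"]
      orbit_of_closed[OF f' x] f
    by (metis PLo.inv_inv subsetI)
qed

section \<open>Orbitals on which an element moves points to the right\<close>

text \<open>A component of the support of \<open>f\<close>, described by its ends instead of by a
  convex hull. One on which \<open>f\<close> lowers points is a right orbital of the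
  inverse.\<close>

definition right_orbital :: "(real \<Rightarrow> real) \<Rightarrow> real \<Rightarrow> real \<Rightarrow> bool" where
  "right_orbital f a b \<longleftrightarrow> 0 \<le> a \<and> a < b \<and> b \<le> 1 \<and> f a = a \<and> f b = b \<and> (\<forall>t\<in>{a<..<b}. t < f t)"

text \<open>The orbit is invariant under \<open>f\<close> and its inverse, so its infimum and
  supremum are fixed. A point between them that \<open>f\<close> did not raise would be a barrier
  confining the whole orbit to one side.\<close>

lemma right_orbital_around:
  assumes f: "f \<in> carrier PLo" and x: "x \<in> {0..1}" and lt: "x < f x"
  shows "right_orbital f (Inf (orbit_of f x)) (Sup (orbit_of f x))"
    and "Inf (orbit_of f x) < x" and "x < Sup (orbit_of f x)"
proof -
  let ?O = "orbit_of f x" and ?g = "inv\<^bsub>PLo\<^esub> f"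
  define a b where "a = Inf ?O" and "b = Sup ?O"
  have g: "?g \<in> carrier PLo" using f by simp
  note cl = orbit_of_closed[OF f x]
  have bdd: "bdd_above ?O" "bdd_below ?O"
    using cl(4) unfolding bdd_above_def bdd_below_def by (meson atLeastAtMost_iff)+
  have ne: "?O \<noteq> {}" using cl(1) by blast
  have ub: "w \<le> b" and lb: "a \<le> w" if "w \<in> ?O" for w
    unfolding a_def b_def using that bdd by (auto intro: cSup_upper cInf_lower)
  have I: "a \<in> {0..1}" "b \<in> {0..1}"
    using cl(1,4) ub lb cSup_least[OF ne, of 1] cInf_greatest[OF ne, of 0]
    unfolding a_def[symmetric] b_def[symmetric] by force+
  have near_b: "\<exists>w\<in>?O. t < w" if "t < b" for t
    using that less_cSup_iff[OF ne bdd(1)] unfolding b_def by blast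
  have near_a: "\<exists>w\<in>?O. w < t" if "a < t" for t
    using that cInf_less_iff[OF ne bdd(2)] unfolding a_def by blast
  show bx: "x < b" using lt ub[OF cl(2)[OF cl(1)]] by auto
  have inv_lt: "?g y < y" if "y \<in> {0..1}" "y < f y" for y
    using that PLo_less_iff[OF f PLo_maps[OF g that(1)] that(1)] PLo_inv_apply[OF f] by auto
  show ax: "a < x" using inv_lt[OF x lt] lb[OF cl(3)[OF cl(1)]] by linarith
  \<comment> \<open>If \<open>f\<close> moved \<open>b\<close> either way, then \<open>f\<close> or
    its inverse would carry an orbit point close to \<open>b\<close> beyond \<open>b\<close>; the
    argument for \<open>a\<close> is symmetric.\<close>
  have fb: "f b = b"
  proof (rule linorder_cases[of "f b" b])
    assume "f b < b"
    then obtain w where w: "w \<in> ?O" "f b < w" using near_b by blast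
    then have "b < ?g w"
      using PLo_less_iff[OF g PLo_maps[OF f I(2)] cl(4)] PLo_inv_apply[OF f I(2)] by metis
    then show ?thesis using ub[OF cl(3)] w by force
  next
    assume "b < f b"
    then have "?g b < b" using inv_lt I by blast
    then obtain w where w: "w \<in> ?O" "?g b < w" using near_b by blast
    then have "b < f w"
      using PLo_less_iff[OF f PLo_maps[OF g I(2)] cl(4)] PLo_inv_apply[OF f I(2)] by metis
    then show ?thesis using ub[OF cl(2)] w by force
  qed simp_all
  have fa: "f a = a"
  proof (rule linorder_cases[of a "f a"])
    assume "a < f a"
    then obtain w where w: "w \<in> ?O" "w < f a" using near_a by blast
    then have "?g w < a"
      using PLo_less_iff[OF g cl(4) PLo_maps[OF f I(1)]] PLo_inv_apply[OF f I(1)] by metis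
    then show ?thesis using lb[OF cl(3)] w by force
  next
    assume "f a < a"
    then have "a < ?g a"
      using PLo_less_iff[OF f I(1) PLo_maps[OF g I(1)]] PLo_inv_apply[OF f I(1)] by metis
    then obtain w where w: "w \<in> ?O" "w < ?g a" using near_a by blast
    then have "f w < a"
      using PLo_less_iff[OF f cl(4) PLo_maps[OF g I(1)]] PLo_inv_apply[OF f I(1)] by metis
    then show ?thesis using lb[OF cl(2)] w by force
  qed simp_all
  \<comment> \<open>Being raised by \<open>f\<close> is preserved along the orbit. Added to the
    barrier condition, it is what the inverse needs when the orbit starts at or left of
    \<open>t\<close>, and what \<open>f\<close> needs when it starts right of
    \<open>t\<close>.\<close>
  have push: "f y < f (f y)" if "y \<in> {0..1}" "y < f y" for y
    using that PLo_less_iff[OF f that(1) PLo_maps[OF f that(1)]] by blast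
  have pull: "?g y < f (?g y)" if "y \<in> {0..1}" "y < f y" for y
    using inv_lt[OF that] PLo_inv_apply(2)[OF f that(1)] by linarith
  have "t < f t" if t: "a < t" "t < b" for t
  proof (rule ccontr)
    assume "\<not> ?thesis"
    then have ft: "f t \<le> t" by simp
    have tI: "t \<in> {0..1}" using t I by auto
    have gt: "t \<le> ?g t"
      using ft PLo_le_iff[OF g PLo_maps[OF f tI] tI] PLo_inv_apply[OF f tI] by metis
    show False
    proof (cases "x \<le> t")
      case True
      have fle: "f y \<le> t" if "y \<in> {0..1}" "y \<le> t" for y
        using ft that PLo_le_iff[OF f that(1) tI] by linarith
      have gle: "?g y \<le> t" if "y \<in> {0..1}" "y < f y" "y \<le> t" for y
        using inv_lt[OF that(1,2)] that(3) by linarith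
      have "w \<le> t" if "w \<in> ?O" for w
        using orbit_of_invariant[OF f x, of "\<lambda>y. y < f y \<and> y \<le> t" w]
          lt True that push pull fle gle by blast
      then show False using near_b[OF t(2)] by force
    next
      case False
      have fgt: "t < f y" if "y < f y" "t < y" for y
        using that by linarith
      have ggt: "t < ?g y" if "y \<in> {0..1}" "t < y" for y
        using gt that PLo_less_iff[OF g tI that(1)] by linarith
      have "t < w" if "w \<in> ?O" for w
      proof -
        have "w \<in> {0..1} \<and> w < f w \<and> t < w"
        proof (rule orbit_of_invariant[OF f x _ _ _ that])
          show "x < f x \<and> t < x" using lt False by simp
          show "f y < f (f y) \<and> t < f y" if "y \<in> {0..1}" "y < f y \<and> t < y" for y
            using that push fgt by blast
          show "?g y < f (?g y) \<and> t < ?g y" if "y \<in> {0..1}" "y < f y \<and> t < y" for y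
            using that pull ggt by blast
        qed
        then show ?thesis by blast
      qed
      then show False using near_a[OF t(1)] by force
    qed
  qed
  then show "right_orbital f a b"
    using I ax bx fa fb unfolding right_orbital_def by auto
qed

text \<open>An open interval that is the hull of an orbit has the infimum and supremum of the orbit
  as its ends. The base point is not fixed, since otherwise the hull would be a single point; so
  \<open>f\<close> or its inverse raises it, and both have the same orbit.\<close>

lemma element_orbital_cases:
  assumes f: "f \<in> carrier PLo" and orb: "element_orbital f {a<..<b}"
  obtains "right_orbital f a b" | "right_orbital (inv\<^bsub>PLo\<^esub> f) a b"
proof -
  let ?g = "inv\<^bsub>PLo\<^esub> f"
  have g: "?g \<in> carrier PLo" using f by simp
  obtain x y z where x: "x \<in> {0..1}" and hull: "{a<..<b} = convex hull (orbit_of f x)"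
    and yz: "y \<in> {a<..<b}" "z \<in> {a<..<b}" "y \<noteq> z"
    using orb unfolding element_orbital_def orbital_def by blast
  let ?O = "orbit_of f x"
  have ab: "a < b" using yz by auto
  have sub: "?O \<subseteq> {a<..<b}" using hull hull_subset by metis
  have ne: "?O \<noteq> {}" using orbit_of_closed(1)[OF f x] by blast
  have bdd: "bdd_above ?O" "bdd_below ?O"
    using bdd_above_mono[OF bdd_above_Ioo sub] bdd_below_mono[OF bdd_below_Ioo sub] by auto
  have "Sup ?O = b"
  proof (rule antisym)
    show "Sup ?O \<le> b" using sub by (intro cSup_least[OF ne]) force
    \<comment> \<open>A closed half-line containing the orbit contains its hull, so every point of
      the interval is at most \<open>Sup ?O\<close>; by density so is the end
      \<open>b\<close>.\<close>
    have "convex hull ?O \<subseteq> {..Sup ?O}"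
      by (rule hull_minimal) (auto intro: cSup_upper bdd)
    then show "b \<le> Sup ?O" using hull by (intro dense_le_bounded[OF ab]) auto
  qed
  moreover have "Inf ?O = a"
  proof (rule antisym)
    show "a \<le> Inf ?O" using sub by (intro cInf_greatest[OF ne]) force
    have "convex hull ?O \<subseteq> {Inf ?O..}"
      by (rule hull_minimal) (auto intro: cInf_lower bdd)
    then show "Inf ?O \<le> a" using hull by (intro dense_ge_bounded[OF ab]) auto
  qed
  moreover have "f x \<noteq> x"
  proof
    assume fx: "f x = x"
    then have "?g x = x" using PLo_inv_apply[OF f x] by metis
    then have "?O \<subseteq> {x}" using orbit_of_invariant[OF f x, of "\<lambda>y. y = x"] fx by blast
    then have "?O = {x}" using ne by (metis subset_singletonD)
    then have "{a<..<b} = {x}" using hull by (simp only: convex_hull_singleton)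
    then show False using yz by (metis singletonD)
  qed
  moreover have "x < ?g x" if "f x < x"
    using that PLo_less_iff[OF f x PLo_maps[OF g x]] PLo_inv_apply[OF f x] by metis
  ultimately show ?thesis
    using right_orbital_around(1)[OF f x] right_orbital_around(1)[OF g x]
      orbit_of_inv[OF f x] that by (metis linorder_neqE_linordered_idom)
qed

text \<open>The orbit of the midpoint stays inside because the ends are fixed. Its infimum and
  supremum are fixed too, and no interior point is fixed, so they are \<open>a\<close> and
  \<open>b\<close>. Hence the hull of the orbit fills the interval.\<close>

lemma right_orbital_element_orbital:
  assumes f: "f \<in> carrier PLo" and orb: "right_orbital f a b"
  shows "element_orbital f {a<..<b}"
proof -
  define x where "x = (a + b) / 2"
  have ab: "0 \<le> a" "b \<le> 1" "f a = a" "f b = b" and mv: "\<And>t. a < t \<Longrightarrow> t < b \<Longrightarrow> t < f t"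
    and lt: "a < b"
    using orb unfolding right_orbital_def by auto
  have x: "a < x" "x < b" using lt by (simp_all add: x_def)
  have xI: "x \<in> {0..1}" using ab x by auto
  let ?O = "orbit_of f x" and ?g = "inv\<^bsub>PLo\<^esub> f"
  have g: "?g \<in> carrier PLo" using f by simp
  have I: "a \<in> {0..1}" "b \<in> {0..1}" using ab x by auto
  have gab: "?g a = a" "?g b = b" using ab PLo_inv_apply[OF f] I by metis+
  have sub: "?O \<subseteq> {a<..<b}"
  proof
    fix w assume "w \<in> ?O"
    moreover have "f y \<in> {a<..<b}" "?g y \<in> {a<..<b}" if "y \<in> {0..1}" "y \<in> {a<..<b}" for y
      using that PLo_less_iff[OF f] PLo_less_iff[OF g] I ab gab
      by (metis greaterThanLessThan_iff)+
    ultimately show "w \<in> {a<..<b}"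
      using orbit_of_invariant[OF f xI, of "\<lambda>y. y \<in> {a<..<b}" w] x by auto
  qed
  have same: "Inf ?O = a" "Sup ?O = b"
  proof -
    have ra: "right_orbital f (Inf ?O) (Sup ?O)" "Inf ?O < x" "x < Sup ?O"
      using right_orbital_around[OF f xI] mv x by auto
    have "?O \<noteq> {}" using orbit_of_closed(1)[OF f xI] by blast
    then have "a \<le> Inf ?O" "Sup ?O \<le> b"
      using sub by (force intro: cInf_greatest cSup_least)+
    moreover have "\<not> a < Inf ?O" "\<not> Sup ?O < b"
      using ra mv[of "Inf ?O"] mv[of "Sup ?O"] x unfolding right_orbital_def by auto
    ultimately show "Inf ?O = a" "Sup ?O = b" by auto
  qed
  have ne: "?O \<noteq> {}" using orbit_of_closed(1)[OF f xI] by blast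
  have bdd: "bdd_above ?O" "bdd_below ?O"
    using bdd_above_mono[OF bdd_above_Ioo sub] bdd_below_mono[OF bdd_below_Ioo sub] by auto
  have "{a<..<b} \<subseteq> convex hull ?O"
  proof
    fix t assume t: "t \<in> {a<..<b}"
    obtain p where p: "p \<in> ?O" "p < t"
      using t cInf_less_iff[OF ne bdd(2), of t] unfolding same greaterThanLessThan_iff by blast
    obtain q where q: "q \<in> ?O" "t < q"
      using t less_cSup_iff[OF ne bdd(1), of t] unfolding same greaterThanLessThan_iff by blast
    have "closed_segment p q \<subseteq> convex hull ?O"
      by (intro closed_segment_subset_convex_hull hull_inc p(1) q(1))
    then show "t \<in> convex hull ?O" using p(2) q(2) by (auto simp: closed_segment_eq_real_ivl)
  qed
  moreover have "convex hull ?O \<subseteq> {a<..<b}"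
    by (rule hull_minimal[OF sub]) simp
  ultimately have "{a<..<b} = convex hull ?O" by (rule equalityI)
  moreover have "x \<in> {a<..<b}" "(a + x) / 2 \<in> {a<..<b}" "x \<noteq> (a + x) / 2"
    using x by auto
  ultimately show ?thesis
    using xI unfolding element_orbital_def orbital_def by meson
qed

section \<open>Finiteness of the set of left ends\<close>

text \<open>A left end is determined by the breaks at or before it. Without a break between two left
  ends, \<open>f\<close> would be affine there with two fixed points, hence the identity, yet it
  moves the points just right of the first end.\<close>

lemma finite_right_orbital_ends:
  assumes f: "f \<in> carrier PLo"
  shows "finite {a. \<exists>b. right_orbital f a b}" (is "finite ?E")
proof -
  obtain B where B: "finite B" "\<And>a b. 0 \<le> a \<and> a < b \<and> b \<le> 1 \<and> {a<..<b} \<inter> B = {} \<Longrightarrow>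
       (\<exists>m c. \<forall>t\<in>{a..b}. f t = m * t + c)"
    using f unfolding PLo_def piecewise_linear_def by auto
  have no_pair: False
    if xy: "x < y" "x \<in> ?E" "y \<in> ?E" "B \<inter> {..x} = B \<inter> {..y}" for x y
  proof -
    obtain b where b: "right_orbital f x b" using xy by blast
    have I: "0 \<le> x" "y \<le> 1" "f x = x" "f y = y"
      using xy by (auto simp: right_orbital_def)
    have "{x<..<y} \<inter> B = {}" using xy(1,4) by force
    then obtain m c where mc: "\<forall>t\<in>{x..y}. f t = m * t + c" using B(2) xy(1) I by metis
    have "m * x + c = x" "m * y + c = y" using mc I xy(1) by auto
    then have "(m - 1) * (y - x) = 0" by (simp add: algebra_simps)
    then have mc1: "m = 1" "c = 0" using xy(1) \<open>m * x + c = x\<close> by auto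
    \<comment> \<open>The minimum puts \<open>z\<close> both in the affine piece, where
      \<open>f\<close> is the identity, and in the orbital, where \<open>f\<close> moves it.\<close>
    obtain z where z: "x < z" "z < y" "z < b"
      using dense[of x "min y b"] xy(1) b unfolding right_orbital_def by auto
    have "f z = z" using mc z mc1 by auto
    then show False using b z unfolding right_orbital_def by force
  qed
  have "inj_on (\<lambda>x. B \<inter> {..x}) ?E"
    using no_pair by (intro inj_onI) (metis linorder_neqE_linordered_idom)
  moreover have "finite ((\<lambda>x. B \<inter> {..x}) ` ?E)"
    by (rule finite_subset[of _ "Pow B"]) (use B(1) in auto)
  ultimately show ?thesis using finite_image_iff by blast
qed

section \<open>Conjugates of orbitals and ascending towers\<close>

text \<open>With elements acting on the right, the product takes \<open>h t\<close> to
  \<open>h (f t)\<close>. As \<open>h\<close> is increasing, it raises the image of every point that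
  \<open>f\<close> raises.\<close>

lemma right_orbital_conjugate:
  assumes f: "f \<in> carrier PLo" and h: "h \<in> carrier PLo" and orb: "right_orbital f a b"
  shows "right_orbital (inv\<^bsub>PLo\<^esub> h \<otimes>\<^bsub>PLo\<^esub> f \<otimes>\<^bsub>PLo\<^esub> h) (h a) (h b)"
proof -
  have I: "a \<in> {0..1}" "b \<in> {0..1}" and ab: "a < b" "f a = a" "f b = b"
    using orb unfolding right_orbital_def by auto
  have h': "inv\<^bsub>PLo\<^esub> h \<in> carrier PLo" using h by simp
  have val: "(inv\<^bsub>PLo\<^esub> h \<otimes>\<^bsub>PLo\<^esub> f \<otimes>\<^bsub>PLo\<^esub> h) (h t) = h (f t)" if "t \<in> {0..1}" for t
    using that PLo_maps[OF h] PLo_inv_apply[OF h] by (simp add: PLo_mult_apply)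
  have "s < (inv\<^bsub>PLo\<^esub> h \<otimes>\<^bsub>PLo\<^esub> f \<otimes>\<^bsub>PLo\<^esub> h) s" if s: "h a < s" "s < h b" for s
  proof -
    have sI: "s \<in> {0..1}"
      using s PLo_maps[OF h I(1)] PLo_maps[OF h I(2)] by auto
    define t where "t = (inv\<^bsub>PLo\<^esub> h) s"
    have t: "t \<in> {0..1}" "s = h t"
      using PLo_maps[OF h' sI] PLo_inv_apply[OF h sI] by (auto simp: t_def)
    then have "a < t" "t < b" using s PLo_less_iff[OF h] I by auto
    then have "t < f t" using orb unfolding right_orbital_def by auto
    then show ?thesis using val t PLo_less_iff[OF h t(1) PLo_maps[OF f t(1)]] by simp
  qed
  then show ?thesis
    using val[OF I(1)] val[OF I(2)] ab PLo_maps[OF h I(1)] PLo_maps[OF h I(2)]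
      PLo_less_iff[OF h I] unfolding right_orbital_def by auto
qed

text \<open>Strict inclusion of the sets already gives comparability in
  \<open>signed_orbital_le\<close>. Distinct indices have distinct sets, which yields both the
  uniqueness condition and infinitude.\<close>

lemma tower_of_strict_chain:
  fixes A :: "nat \<Rightarrow> real set"
  assumes orb: "\<And>n. signed_orbital G (A n, f n)" and A: "\<And>n. A n \<subset> A (Suc n)"
  shows "\<exists>T. tower G T \<and> infinite T"
proof -
  have mono: "A m \<subset> A n" if "m < n" for m n
    using lift_Suc_mono_less[of A, OF A that] .
  then have inj: "A m = A n \<longleftrightarrow> m = n" for m n
    by (metis linorder_neqE_nat psubset_eq)
  let ?T = "range (\<lambda>n. (A n, f n))"
  have "signed_orbital_le (A m, f m) (A n, f n) \<or> signed_orbital_le (A n, f n) (A m, f m)" for m n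
    using mono[of m n] mono[of n m] unfolding signed_orbital_le_def
    by (cases m n rule: linorder_cases) auto
  then have "Complete_Partial_Order.chain signed_orbital_le ?T"
    unfolding Complete_Partial_Order.chain_def by blast
  moreover have "\<forall>S\<in>fst ` ?T. \<exists>!g. (S, g) \<in> ?T" using inj by auto
  ultimately have "tower G ?T" using orb unfolding tower_def by auto
  moreover have "infinite ?T"
    using inj by (intro range_inj_infinite injI) auto
  ultimately show ?thesis by blast
qed

text \<open>Conjugating \<open>f\<close> by the powers of \<open>h\<close> moves its orbital by
  these powers. The left ends never increase, while the right ends stay in the orbital of
  \<open>h\<close> and increase strictly.\<close>

lemma infinite_tower_if_left_end_not_increased:
  assumes H: "subgroup H PLo" and fh: "f \<in> H" "h \<in> H"
    and f: "right_orbital f a1 a2" and h: "right_orbital h b1 b2"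
    and a2: "b1 < a2" "a2 < b2" and a1: "h a1 \<le> a1"
  shows "\<exists>T. tower H T \<and> infinite T"
proof -
  interpret subgroup H PLo by (rule H)
  have c: "f \<in> carrier PLo" "h \<in> carrier PLo" using fh mem_carrier by auto
  define k where "k n = ((\<lambda>k. inv\<^bsub>PLo\<^esub> h \<otimes>\<^bsub>PLo\<^esub> k \<otimes>\<^bsub>PLo\<^esub> h) ^^ n) f" for n
  define a where "a n = (h ^^ n) a1" for n
  define b where "b n = (h ^^ n) a2" for n
  have kH: "k n \<in> H" for n
    unfolding k_def using fh by (induction n) (auto intro!: m_closed m_inv_closed)
  have ro: "right_orbital (k n) (a n) (b n)" for n
  proof (induction n)
    case 0 then show ?case using f by (simp add: k_def a_def b_def)
  next
    case (Suc n)
    then show ?case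
      using right_orbital_conjugate[OF mem_carrier[OF kH] c(2) Suc] by (simp add: k_def a_def b_def)
  qed
  have I: "a n \<in> {0..1}" "b n \<in> {0..1}" "a n < b n" for n
    using ro[of n] unfolding right_orbital_def by auto
  have a_dec: "a (Suc n) \<le> a n" for n
  proof (induction n)
    case 0 then show ?case using a1 by (simp add: a_def)
  next
    case (Suc n) then show ?case
      using PLo_le_iff[OF c(2) I(1)[of "Suc n"] I(1)[of n]] by (simp add: a_def)
  qed
  have hb: "b1 \<in> {0..1}" "b2 \<in> {0..1}" "h b1 = b1" "h b2 = b2"
    "\<And>t. b1 < t \<Longrightarrow> t < b2 \<Longrightarrow> t < h t"
    using h unfolding right_orbital_def by auto
  \<comment> \<open>The ends of the orbital of \<open>h\<close> are fixed, so the increasing map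
    \<open>h\<close> keeps \<open>b n\<close> between them.\<close>
  have b_in: "b1 < b n \<and> b n < b2" for n
  proof (induction n)
    case 0 then show ?case using a2 by (simp add: b_def)
  next
    case (Suc n)
    have "b (Suc n) = h (b n)" by (simp add: b_def)
    then show ?case
      using Suc hb PLo_less_iff[OF c(2) hb(1) I(2)[of n]] PLo_less_iff[OF c(2) I(2)[of n] hb(2)]
      by simp
  qed
  then have b_inc: "b n < b (Suc n)" for n using hb(5)[of "b n"] by (simp add: b_def)
  show ?thesis
  proof (rule tower_of_strict_chain)
    show "signed_orbital H ({a n<..<b n}, k n)" for n
      using kH mem_carrier right_orbital_element_orbital ro unfolding signed_orbital_def by auto
    \<comment> \<open>The old right end witnesses strictness: it lies in the next interval but not
      in its own open interval.\<close>
    have "b n \<in> {a (Suc n)<..<b (Suc n)}" for n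
      using a_dec[of n] b_inc[of n] I(3)[of n] by auto
    moreover have "{a n<..<b n} \<subseteq> {a (Suc n)<..<b (Suc n)}" for n
      using a_dec[of n] b_inc[of n] by auto
    ultimately show "{a n<..<b n} \<subset> {a (Suc n)<..<b (Suc n)}" for n
      by (metis greaterThanLessThan_iff less_irrefl psubsetI)
  qed
qed

section \<open>The leftmost chain\<close>

text \<open>Only the left end is an argument, as the extremal choice is made over it; the order of
  \<open>f\<close> and \<open>h\<close> records which of them has the left orbital.\<close>

definition right_chain_from :: "(real \<Rightarrow> real) \<Rightarrow> (real \<Rightarrow> real) \<Rightarrow> real \<Rightarrow> bool" where
  "right_chain_from f h a1 \<longleftrightarrow> (\<exists>a2 b1 b2. right_orbital f a1 a2 \<and> right_orbital h b1 b2 \<and>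
     a1 < b1 \<and> b1 < a2 \<and> a2 < b2)"

text \<open>The orbital of \<open>h\<close> around \<open>a\<close> cannot contain the fixed point
  \<open>b1\<close>, so it ends at or before \<open>b1\<close>, hence before \<open>a2\<close>. It
  overlaps the orbital of \<open>f\<close> from the left, and the two elements exchange
  roles.\<close>

lemma right_chain_extend_left:
  assumes h: "h \<in> carrier PLo" and ch: "right_chain_from f h a" and lt: "a < h a"
  shows "\<exists>c<a. right_chain_from h f c"
proof -
  obtain a2 b1 b2 where *: "right_orbital f a a2" "right_orbital h b1 b2"
     "a < b1" "b1 < a2" "a2 < b2"
    using ch unfolding right_chain_from_def by blast
  have aI: "a \<in> {0..1}" using * unfolding right_orbital_def by auto
  obtain c d where cd: "right_orbital h c d" "c < a" "a < d"
    using right_orbital_around[OF h aI lt] by blast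
  have "h b1 = b1" using *(2) unfolding right_orbital_def by blast
  then have "b1 \<notin> {c<..<d}" using cd(1) unfolding right_orbital_def by (metis less_irrefl)
  then have "d < a2" using cd(2) * by auto
  then show ?thesis
    using cd *(1) unfolding right_chain_from_def by blast
qed

theorem lemma1p4:
  fixes H :: "(real \<Rightarrow> real) set"
  assumes "subgroup H PLo"
    and "admits_transition_chain_two H"
  shows "\<exists>T. tower H T \<and> infinite T"
proof -
  interpret subgroup H PLo by (rule assms(1))
  obtain a1 a2 b1 b2 g h where gh: "g \<in> H" "h \<in> H" "element_orbital g {a1<..<a2}"
    "element_orbital h {b1<..<b2}" and ab: "a1 < b1" "b1 < a2" "a2 < b2"
    using assms(2) unfolding admits_transition_chain_two_def signed_orbital_def by auto
  \<comment> \<open>Each element is replaced by its inverse where necessary, so that it raises the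
    points of its own orbital; the two choices are independent.\<close>
  obtain u where u: "u \<in> H" "right_orbital u a1 a2"
    using element_orbital_cases[OF mem_carrier gh(3)] gh(1) m_inv_closed by metis
  obtain v where v: "v \<in> H" "right_orbital v b1 b2"
    using element_orbital_cases[OF mem_carrier gh(4)] gh(2) m_inv_closed by metis
  define S where "S = {a. right_chain_from u v a \<or> right_chain_from v u a}"
  have "S \<subseteq> {a. \<exists>b. right_orbital u a b} \<union> {a. \<exists>b. right_orbital v a b}"
    unfolding S_def right_chain_from_def by auto
  then have fin: "finite S"
    using finite_right_orbital_ends mem_carrier u(1) v(1) by (meson finite_UnI finite_subset)
  have "a1 \<in> S" using u v ab unfolding S_def right_chain_from_def by blast
  then have "Min S \<in> S" using Min_in[OF fin] by blast
  \<comment> \<open>\<open>p\<close> and \<open>q\<close> are \<open>u\<close> and \<open>v\<close>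
    in the order in which they form the leftmost chain.\<close>
  then obtain p q where pq: "p \<in> H" "q \<in> H" "right_chain_from p q (Min S)"
    and S: "\<And>a. right_chain_from q p a \<Longrightarrow> a \<in> S"
    using u(1) v(1) unfolding S_def by blast
  \<comment> \<open>If \<open>q\<close> raised the minimum, extending the chain would give a smaller
    member of \<open>S\<close>.\<close>
  have "q (Min S) \<le> Min S"
    using right_chain_extend_left[OF mem_carrier[OF pq(2)] pq(3)] Min_le[OF fin] S by (meson not_le)
  then show ?thesis
    using infinite_tower_if_left_end_not_increased[OF assms(1) pq(1,2)] pq(3)
    unfolding right_chain_from_def by blast
qed

end
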